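(* Let $\sigma>0$, $k>0$, $P=\mathcal N(0,\sigma^2)$ and, for $\tau>0$, $Q_\tau=\mathcal N(0,\tau^2)$. Then $J(\tau):=k^2W_2^2(P,Q_\tau)+\operatorname{mmse}(Q_\tau)$ satisfies $$J(\tau)=k^2(\sigma-\tau)^2+\frac{\tau^2}{1+\tau^2},\qquad \tau>0.$$
   Context: $W_2^2(P,Q)=\inf_\pi\int(x-y)^2\,\pi(dx,dy)$ over couplings $\pi$ of $P$ and $Q$. $\operatorname{mmse}(Q)=\mathbb E[\operatorname{Var}(Y\mid Y+N)]$ for independent $Y\sim Q$, $N\sim\mathcal N(0,1)$. *)

theory Defs
  imports "HOL-Probability.Probability"
begin

text \<open>The parameter \<open>s\<close> is the standard deviation, as in \<^const>\<open>normal_density\<close>.\<close>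

definition gaussian :: "real \<Rightarrow> real \<Rightarrow> real measure" where
  "gaussian m s = density lborel (\<lambda>x. ennreal (normal_density m s x))"

definition couplings :: "real measure \<Rightarrow> real measure \<Rightarrow> (real \<times> real) measure set" where
  "couplings P Q = {\<pi>. sets \<pi> = sets (borel :: (real \<times> real) measure) \<and>
     distr \<pi> borel fst = P \<and> distr \<pi> borel snd = Q}"

text \<open>Transport costs and conditional variances are extended nonnegative reals, so an
  infinite value stays \<open>\<infinity>\<close> instead of collapsing to \<open>0\<close>.\<close>

definition W2_sq :: "real measure \<Rightarrow> real measure \<Rightarrow> ennreal" where
  "W2_sq P Q = (INF \<pi>\<in>couplings P Q. \<integral>\<^sup>+ (x, y). ennreal ((x - y)\<^sup>2) \<partial>\<pi>)"

text \<open>Meaningful for integrable \<open>Y\<close>: \<^const>\<open>real_cond_exp\<close> is only characterised there.\<close>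

definition cond_variance :: "'a measure \<Rightarrow> 'a measure \<Rightarrow> ('a \<Rightarrow> real) \<Rightarrow> 'a \<Rightarrow> ennreal" where
  "cond_variance M F Y =
     nn_cond_exp M F (\<lambda>\<omega>. ennreal ((Y \<omega> - real_cond_exp M F Y \<omega>)\<^sup>2))"

definition cond_variance_given ::
  "'a measure \<Rightarrow> ('a \<Rightarrow> real) \<Rightarrow> ('a \<Rightarrow> real) \<Rightarrow> 'a \<Rightarrow> ennreal" where
  "cond_variance_given M Y Z = cond_variance M (vimage_algebra (space M) Z borel) Y"

text \<open>The independent pair \<open>(Y, N)\<close> is realised as the coordinates of the product space
  \<open>Q \<Otimes>\<^sub>M N(0,1)\<close>; the value depends only on their joint law.\<close>

definition mmse :: "real measure \<Rightarrow> ennreal" where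
  "mmse Q = (let M = Q \<Otimes>\<^sub>M gaussian 0 1 in
     \<integral>\<^sup>+ \<omega>. cond_variance_given M fst (\<lambda>\<omega>. fst \<omega> + snd \<omega>) \<omega> \<partial>M)"

definition J :: "real \<Rightarrow> real \<Rightarrow> real \<Rightarrow> ennreal" where
  "J k \<sigma> \<tau> = ennreal (k\<^sup>2) * W2_sq (gaussian 0 \<sigma>) (gaussian 0 \<tau>) + mmse (gaussian 0 \<tau>)"

end

theory Submission
  imports Defs
begin

text \<open>For \<open>t = \<tau> / \<sigma>\<close> the pointwise bound \<open>2 x y \<le> t x\<^sup>2 + y\<^sup>2 / t\<close> bounds the cost of every
  coupling below by \<open>(\<sigma> - \<tau>)\<^sup>2\<close>, and the coupling carried by the line \<open>y = t x\<close> attains it. For the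
  mean square error, with \<open>c = \<tau>\<^sup>2 / (1 + \<tau>\<^sup>2)\<close> the residual \<open>Y - c (Y + N)\<close> is independent of
  \<open>Y + N\<close> and centred with variance \<open>c\<close>; hence \<open>c (Y + N)\<close> is the conditional mean and \<open>c\<close> the
  error.\<close>

section \<open>Moments of centred Gaussian laws\<close>

lemma sets_gaussian [simp, measurable_cong]: "sets (gaussian m s) = sets borel"
  by (simp add: gaussian_def)

lemma space_gaussian [simp]: "space (gaussian m s) = UNIV"
  by (simp add: gaussian_def)

lemma prob_space_gaussian: "0 < s \<Longrightarrow> prob_space (gaussian m s)"
  by (simp add: gaussian_def prob_space_normal_density)

lemma nn_integral_gaussian:
  assumes [measurable]: "f \<in> borel_measurable borel"
  shows "(\<integral>\<^sup>+x. f x \<partial>gaussian m s) = (\<integral>\<^sup>+x. ennreal (normal_density m s x) * f x \<partial>lborel)"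
  by (simp add: gaussian_def nn_integral_density)

lemma has_bochner_integral_gaussian:
  fixes f :: "real \<Rightarrow> real"
  assumes [measurable]: "f \<in> borel_measurable borel"
    and "has_bochner_integral lborel (\<lambda>x. normal_density m s x * f x) I"
  shows "has_bochner_integral (gaussian m s) f I"
  using assms(2) by (simp add: gaussian_def has_bochner_integral_density)

lemma gaussian_mean:
  assumes "0 < s"
  shows "has_bochner_integral (gaussian 0 s) (\<lambda>x. x) 0"
  using normal_moment_nz_1[OF assms, of 0]
  by (intro has_bochner_integral_gaussian) simp_all

lemma gaussian_second_moment:
  assumes "0 < s"
  shows "has_bochner_integral (gaussian 0 s) (\<lambda>x. x\<^sup>2) (s\<^sup>2)"
  using normal_moment_even[OF assms, of 0 1]
  by (intro has_bochner_integral_gaussian) (simp_all add: power2_eq_square)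

section \<open>The Wasserstein distance\<close>

text \<open>This supplies both marginals of the coupling that attains the Wasserstein distance: the
  second with factor \<tau> / \<sigma>, the first, an identity map, with factor 1.\<close>

lemma distr_gaussian_scale:
  assumes "0 < s" "0 < a"
  shows "distr (gaussian 0 s) borel (\<lambda>x. a * x) = gaussian 0 (a * s)"
proof -
  interpret prob_space "gaussian 0 s" by (rule prob_space_gaussian[OF assms(1)])
  have "distributed (gaussian 0 s) lborel (\<lambda>x. x) (normal_density 0 s)"
    by (auto simp: distributed_def gaussian_def intro!: measure_eqI)
      (simp add: emeasure_distr)
  from normal_density_affine[OF this assms(1), of a 0] assms(2)
  have "distributed (gaussian 0 s) lborel (\<lambda>x. a * x) (normal_density 0 (a * s))"
    by simp
  then have "distr (gaussian 0 s) lborel (\<lambda>x. a * x) = gaussian 0 (a * s)"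
    by (simp add: distributed_def gaussian_def)
  moreover have "distr (gaussian 0 s) borel (\<lambda>x. a * x) = distr (gaussian 0 s) lborel (\<lambda>x. a * x)"
    by (rule distr_cong) simp_all
  ultimately show ?thesis by simp
qed

text \<open>The lower bound for the cost is a function of x plus a function of y, so its integral
  depends on the marginals only and is the same for every coupling. This is weak Kantorovich duality
  with quadratic potentials.\<close>

lemma coupling_cost_ge:
  assumes "0 < \<sigma>" "0 < \<tau>" and \<pi>: "\<pi> \<in> couplings (gaussian 0 \<sigma>) (gaussian 0 \<tau>)"
  shows "ennreal ((\<sigma> - \<tau>)\<^sup>2) \<le> (\<integral>\<^sup>+ (x, y). ennreal ((x - y)\<^sup>2) \<partial>\<pi>)"
proof -
  have sets_\<pi>: "sets \<pi> = sets (borel \<Otimes>\<^sub>M borel)"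
    and fst_\<pi>: "distr \<pi> borel fst = gaussian 0 \<sigma>" and snd_\<pi>: "distr \<pi> borel snd = gaussian 0 \<tau>"
    using \<pi> unfolding couplings_def borel_prod by simp_all
  note sets_\<pi>[measurable_cong]
  have moment_fst: "has_bochner_integral \<pi> (\<lambda>p. (fst p)\<^sup>2) (\<sigma>\<^sup>2)"
    using gaussian_second_moment[OF assms(1)] unfolding fst_\<pi>[symmetric]
    by (simp add: has_bochner_integral_iff integrable_distr_eq integral_distr)
  have moment_snd: "has_bochner_integral \<pi> (\<lambda>p. (snd p)\<^sup>2) (\<tau>\<^sup>2)"
    using gaussian_second_moment[OF assms(2)] unfolding snd_\<pi>[symmetric]
    by (simp add: has_bochner_integral_iff integrable_distr_eq integral_distr)
  \<comment> \<open>This is x^2 + y^2 - (t x^2 + y^2 / t) for t = \<tau> / \<sigma>, the value for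
    which the integral of the bound is exactly (\<sigma> - \<tau>)^2.\<close>
  let ?L = "\<lambda>p. (1 - \<tau> / \<sigma>) * (fst p)\<^sup>2 + (1 - \<sigma> / \<tau>) * (snd p)\<^sup>2 :: real"
  have L: "has_bochner_integral \<pi> ?L ((1 - \<tau> / \<sigma>) * \<sigma>\<^sup>2 + (1 - \<sigma> / \<tau>) * \<tau>\<^sup>2)"
    by (intro has_bochner_integral_add has_bochner_integral_mult_right moment_fst moment_snd)
  have L_le: "?L p \<le> (fst p - snd p)\<^sup>2" for p
  proof -
    \<comment> \<open>The gap is a square that vanishes exactly on the line y = (\<tau> / \<sigma>)
      x; this is why the coupling carried by that line is optimal.\<close>
    have "(fst p - snd p)\<^sup>2 - ?L p = (\<tau> * fst p - \<sigma> * snd p)\<^sup>2 / (\<sigma> * \<tau>)"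
      using assms(1,2) by (simp add: field_simps power2_eq_square)
    also have "\<dots> \<ge> 0"
      using assms(1,2) by simp
    finally show ?thesis by simp
  qed
  \<comment> \<open>Unless \<sigma> = \<tau>, the two coefficients in \<open>?L\<close> have
    opposite signs, so the comparison is made between Bochner integrals. Integrability of the cost
    makes this legitimate and allows the return to the nonnegative integral at the end.\<close>
  have int: "integrable \<pi> (\<lambda>p. (fst p - snd p)\<^sup>2)"
  proof (rule Bochner_Integration.integrable_bound)
    show "integrable \<pi> (\<lambda>p. 2 * (fst p)\<^sup>2 + 2 * (snd p)\<^sup>2)"
      using moment_fst moment_snd by (auto simp: has_bochner_integral_iff)
    show "AE p in \<pi>. norm ((fst p - snd p)\<^sup>2) \<le> norm (2 * (fst p)\<^sup>2 + 2 * (snd p)\<^sup>2)"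
    proof (rule AE_I2)
      fix p :: "real \<times> real"
      have "0 \<le> (fst p + snd p)\<^sup>2" by simp
      then have "(fst p - snd p)\<^sup>2 \<le> 2 * (fst p)\<^sup>2 + 2 * (snd p)\<^sup>2"
        by (simp add: power2_sum power2_diff)
      then show "norm ((fst p - snd p)\<^sup>2) \<le> norm (2 * (fst p)\<^sup>2 + 2 * (snd p)\<^sup>2)"
        by simp
    qed
  qed simp
  have "(\<sigma> - \<tau>)\<^sup>2 = (1 - \<tau> / \<sigma>) * \<sigma>\<^sup>2 + (1 - \<sigma> / \<tau>) * \<tau>\<^sup>2"
    using assms(1,2) by (simp add: field_simps power2_eq_square)
  also have "\<dots> \<le> (\<integral>p. (fst p - snd p)\<^sup>2 \<partial>\<pi>)"
    using integral_mono[OF _ int L_le] L unfolding has_bochner_integral_iff by metis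
  finally have "ennreal ((\<sigma> - \<tau>)\<^sup>2) \<le> ennreal (\<integral>p. (fst p - snd p)\<^sup>2 \<partial>\<pi>)"
    by (rule ennreal_leI)
  also have "\<dots> = (\<integral>\<^sup>+ (x, y). ennreal ((x - y)\<^sup>2) \<partial>\<pi>)"
    using nn_integral_eq_integral[OF int] by (simp add: case_prod_beta')
  finally show ?thesis .
qed

lemma W2_sq_gaussian:
  assumes "0 < \<sigma>" "0 < \<tau>"
  shows "W2_sq (gaussian 0 \<sigma>) (gaussian 0 \<tau>) = ennreal ((\<sigma> - \<tau>)\<^sup>2)"
proof (rule antisym)
  let ?T = "\<lambda>x::real. (x, \<tau> / \<sigma> * x)"
  let ?\<pi> = "distr (gaussian 0 \<sigma>) (borel \<Otimes>\<^sub>M borel) ?T"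
  have "distr ?\<pi> borel fst = gaussian 0 \<sigma>"
    using distr_gaussian_scale[of \<sigma> 1] assms
    by (subst distr_distr) (auto simp: comp_def)
  moreover have "distr ?\<pi> borel snd = gaussian 0 \<tau>"
    using distr_gaussian_scale[of \<sigma> "\<tau> / \<sigma>"] assms
    by (subst distr_distr) (auto simp: comp_def)
  ultimately have "?\<pi> \<in> couplings (gaussian 0 \<sigma>) (gaussian 0 \<tau>)"
    by (simp add: couplings_def borel_prod)
  then have "W2_sq (gaussian 0 \<sigma>) (gaussian 0 \<tau>) \<le> (\<integral>\<^sup>+ (x, y). ennreal ((x - y)\<^sup>2) \<partial>?\<pi>)"
    unfolding W2_sq_def by (rule INF_lower)
  also have "\<dots> = (\<integral>\<^sup>+x. ennreal ((1 - \<tau> / \<sigma>)\<^sup>2 * x\<^sup>2) \<partial>gaussian 0 \<sigma>)"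
    by (subst nn_integral_distr) (auto simp: power_mult_distrib[symmetric] left_diff_distrib)
  also have "\<dots> = ennreal ((1 - \<tau> / \<sigma>)\<^sup>2 * \<sigma>\<^sup>2)"
    using has_bochner_integral_mult_right[OF gaussian_second_moment[OF assms(1)], of "(1 - \<tau> / \<sigma>)\<^sup>2"]
    by (subst nn_integral_eq_integral) (auto simp: has_bochner_integral_iff)
  also have "(1 - \<tau> / \<sigma>)\<^sup>2 * \<sigma>\<^sup>2 = (\<sigma> - \<tau>)\<^sup>2"
    using assms by (simp add: power_mult_distrib[symmetric] left_diff_distrib)
  finally show "W2_sq (gaussian 0 \<sigma>) (gaussian 0 \<tau>) \<le> ennreal ((\<sigma> - \<tau>)\<^sup>2)" .
  show "ennreal ((\<sigma> - \<tau>)\<^sup>2) \<le> W2_sq (gaussian 0 \<sigma>) (gaussian 0 \<tau>)"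
    unfolding W2_sq_def by (intro INF_greatest coupling_cost_ge assms)
qed

section \<open>The minimum mean square error\<close>

text \<open>Bayes' rule for densities: the left side is the joint density of Y and Z = Y + N, the
  right side the density of Z times that of Y given Z = z. The conditional law is normal with mean c
  z and variance c, where c = \<tau>^2 / (1 + \<tau>^2).\<close>

lemma normal_density_factor:
  assumes "0 < \<tau>"
  shows "normal_density 0 \<tau> y * normal_density 0 1 (z - y) =
    normal_density 0 (sqrt (1 + \<tau>\<^sup>2)) z *
    normal_density 0 (sqrt (\<tau>\<^sup>2 / (1 + \<tau>\<^sup>2))) (y - \<tau>\<^sup>2 / (1 + \<tau>\<^sup>2) * z)"
proof -
  define v where "v = \<tau>\<^sup>2"
  have v: "0 < v" "0 < 1 + v" "1 + v \<noteq> 0"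
    using assms by (simp_all add: v_def add_pos_pos add_pos_pos[THEN less_imp_neq, symmetric])
  \<comment> \<open>Completing the square in y.\<close>
  have exponent: "- (y\<^sup>2) / (2 * v) + - ((z - y)\<^sup>2) / 2 =
      - (z\<^sup>2) / (2 * (1 + v)) + - ((y - v / (1 + v) * z)\<^sup>2) / (2 * (v / (1 + v)))"
  proof -
    have "y - v / (1 + v) * z = ((1 + v) * y - v * z) / (1 + v)"
      using v by (simp add: field_simps)
    then have "- ((y - v / (1 + v) * z)\<^sup>2) / (2 * (v / (1 + v))) =
        - (((1 + v) * y - v * z)\<^sup>2) / (2 * v * (1 + v))"
      using v by (simp add: power_divide power2_eq_square)
    moreover have "- (y\<^sup>2) / (2 * v) + - ((z - y)\<^sup>2) / 2 =
        - (z\<^sup>2) / (2 * (1 + v)) + - (((1 + v) * y - v * z)\<^sup>2) / (2 * v * (1 + v))"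
      using v by (simp add: divide_simps) (simp add: algebra_simps power2_eq_square)
    ultimately show ?thesis by simp
  qed
  \<comment> \<open>The normalising constants agree because both pairs of variances have the product
    v.\<close>
  have const: "sqrt (2 * pi * v) * sqrt (2 * pi) =
      sqrt (2 * pi * (1 + v)) * sqrt (2 * pi * (v / (1 + v)))"
    using v by (simp add: real_sqrt_mult[symmetric])
  have "normal_density 0 \<tau> y * normal_density 0 1 (z - y) =
      exp (- (y\<^sup>2) / (2 * v) + - ((z - y)\<^sup>2) / 2) / (sqrt (2 * pi * v) * sqrt (2 * pi))"
    unfolding normal_density_def v_def exp_add by simp
  moreover have "normal_density 0 (sqrt (1 + v)) z *
      normal_density 0 (sqrt (v / (1 + v))) (y - v / (1 + v) * z) =
      exp (- (z\<^sup>2) / (2 * (1 + v)) + - ((y - v / (1 + v) * z)\<^sup>2) / (2 * (v / (1 + v)))) /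
      (sqrt (2 * pi * (1 + v)) * sqrt (2 * pi * (v / (1 + v))))"
    using v unfolding normal_density_def exp_add by simp
  ultimately show ?thesis
    by (simp only: exponent const v_def[symmetric])
qed

text \<open>A product law on the right states that observation and residual are independent. It
  follows from the factorisation of the joint density after two changes of variable, both
  translations, so that no Jacobian appears.\<close>

lemma distr_observation_residual:
  assumes "0 < \<tau>"
  shows "distr (gaussian 0 \<tau> \<Otimes>\<^sub>M gaussian 0 1) (borel \<Otimes>\<^sub>M borel)
      (\<lambda>(y, n). (y + n, y - \<tau>\<^sup>2 / (1 + \<tau>\<^sup>2) * (y + n))) =
    gaussian 0 (sqrt (1 + \<tau>\<^sup>2)) \<Otimes>\<^sub>M gaussian 0 (sqrt (\<tau>\<^sup>2 / (1 + \<tau>\<^sup>2)))"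
    (is "distr ?M _ ?T = ?G \<Otimes>\<^sub>M ?H")
proof -
  define c where "c = \<tau>\<^sup>2 / (1 + \<tau>\<^sup>2)"
  have pos: "0 < 1 + \<tau>\<^sup>2" "0 < c" using assms by (simp_all add: c_def add_pos_pos)
  interpret N: prob_space "gaussian 0 1" by (rule prob_space_gaussian) simp
  interpret H: prob_space "gaussian 0 (sqrt c)" by (rule prob_space_gaussian) (simp add: pos)
  have T [measurable]: "?T \<in> ?M \<rightarrow>\<^sub>M borel \<Otimes>\<^sub>M borel" by measurable
  show ?thesis
  proof (rule measure_eqI)
    fix A assume "A \<in> sets (distr ?M (borel \<Otimes>\<^sub>M borel) ?T)"
    then have [measurable]: "A \<in> sets (borel \<Otimes>\<^sub>M borel)" by simp
    let ?f = "\<lambda>z w. indicator A (z, w) :: ennreal"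
    let ?\<phi> = "\<lambda>s x. ennreal (normal_density 0 s x)"
    have "emeasure (distr ?M (borel \<Otimes>\<^sub>M borel) ?T) A =
        (\<integral>\<^sup>+p. indicator A p \<partial>distr ?M (borel \<Otimes>\<^sub>M borel) ?T)"
      by simp
    also have "\<dots> = (\<integral>\<^sup>+p. indicator A (?T p) \<partial>?M)"
      by (rule nn_integral_distr) simp_all
    also have "\<dots> = (\<integral>\<^sup>+y. \<integral>\<^sup>+n. ?f (y + n) (y - c * (y + n)) \<partial>gaussian 0 1 \<partial>gaussian 0 \<tau>)"
      by (subst N.nn_integral_fst[symmetric]) (simp_all add: c_def)
    also have "\<dots> = (\<integral>\<^sup>+y. ?\<phi> \<tau> y * (\<integral>\<^sup>+n. ?\<phi> 1 n * ?f (y + n) (y - c * (y + n)) \<partial>lborel) \<partial>lborel)"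
      by (simp add: nn_integral_gaussian)
    \<comment> \<open>For fixed y substitute z = y + n.\<close>
    also have "\<dots> = (\<integral>\<^sup>+y. \<integral>\<^sup>+z. ?\<phi> \<tau> y * (?\<phi> 1 (z - y) * ?f z (y - c * z)) \<partial>lborel \<partial>lborel)"
    proof (rule nn_integral_cong)
      fix y :: real
      have "(\<integral>\<^sup>+n. ?\<phi> 1 n * ?f (y + n) (y - c * (y + n)) \<partial>lborel) =
          (\<integral>\<^sup>+z. ?\<phi> 1 (z - y) * ?f z (y - c * z) \<partial>lborel)"
        by (subst nn_integral_real_affine[where c = 1 and t = "- y"]) simp_all
      then show "?\<phi> \<tau> y * (\<integral>\<^sup>+n. ?\<phi> 1 n * ?f (y + n) (y - c * (y + n)) \<partial>lborel) =
          (\<integral>\<^sup>+z. ?\<phi> \<tau> y * (?\<phi> 1 (z - y) * ?f z (y - c * z)) \<partial>lborel)"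
        by (simp add: nn_integral_cmult)
    qed
    \<comment> \<open>Tonelli makes y the inner variable, so that below w = y - c z can be
      substituted with z held fixed.\<close>
    also have "\<dots> = (\<integral>\<^sup>+z. \<integral>\<^sup>+y. ?\<phi> \<tau> y * (?\<phi> 1 (z - y) * ?f z (y - c * z)) \<partial>lborel \<partial>lborel)"
      by (rule lborel_pair.Fubini') simp
    also have "\<dots> = (\<integral>\<^sup>+z. \<integral>\<^sup>+y. ?\<phi> (sqrt (1 + \<tau>\<^sup>2)) z *
        (?\<phi> (sqrt c) (y - c * z) * ?f z (y - c * z)) \<partial>lborel \<partial>lborel)"
      using normal_density_factor[OF assms]
      by (simp add: c_def ennreal_mult'[symmetric] mult.assoc[symmetric])
    also have "\<dots> = (\<integral>\<^sup>+z. ?\<phi> (sqrt (1 + \<tau>\<^sup>2)) z * (\<integral>\<^sup>+w. ?\<phi> (sqrt c) w * ?f z w \<partial>lborel) \<partial>lborel)"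
    proof (rule nn_integral_cong)
      fix z :: real
      have "(\<integral>\<^sup>+w. ?\<phi> (sqrt c) w * ?f z w \<partial>lborel) =
          (\<integral>\<^sup>+y. ?\<phi> (sqrt c) (y - c * z) * ?f z (y - c * z) \<partial>lborel)"
        by (subst nn_integral_real_affine[where c = 1 and t = "- (c * z)"]) simp_all
      then show "(\<integral>\<^sup>+y. ?\<phi> (sqrt (1 + \<tau>\<^sup>2)) z * (?\<phi> (sqrt c) (y - c * z) * ?f z (y - c * z)) \<partial>lborel) =
          ?\<phi> (sqrt (1 + \<tau>\<^sup>2)) z * (\<integral>\<^sup>+w. ?\<phi> (sqrt c) w * ?f z w \<partial>lborel)"
        by (simp add: nn_integral_cmult)
    qed
    also have "\<dots> = (\<integral>\<^sup>+z. \<integral>\<^sup>+w. ?f z w \<partial>gaussian 0 (sqrt c) \<partial>gaussian 0 (sqrt (1 + \<tau>\<^sup>2)))"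
      by (simp add: nn_integral_gaussian)
    also have "\<dots> = emeasure (?G \<Otimes>\<^sub>M gaussian 0 (sqrt c)) A"
      by (subst H.nn_integral_fst) simp_all
    finally show "emeasure (distr ?M (borel \<Otimes>\<^sub>M borel) ?T) A = emeasure (?G \<Otimes>\<^sub>M ?H) A"
      by (simp add: c_def)
  qed (auto intro!: sets_pair_measure_cong)
qed

lemma mmse_gaussian:
  assumes "0 < \<tau>"
  shows "mmse (gaussian 0 \<tau>) = ennreal (\<tau>\<^sup>2 / (1 + \<tau>\<^sup>2))"
proof -
  define c where "c = \<tau>\<^sup>2 / (1 + \<tau>\<^sup>2)"
  define M where "M = gaussian 0 \<tau> \<Otimes>\<^sub>M gaussian 0 1"
  define Z :: "real \<times> real \<Rightarrow> real" where "Z = (\<lambda>p. fst p + snd p)"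
  define W where "W = (\<lambda>p. fst p - c * Z p)"
  define F where "F = vimage_algebra (space M) Z borel"
  define G where "G = gaussian 0 (sqrt (1 + \<tau>\<^sup>2))"
  define H where "H = gaussian 0 (sqrt c)"
  have pos: "0 < 1 + \<tau>\<^sup>2" "0 < c" using assms by (simp_all add: c_def add_pos_pos)
  have sets_M [measurable_cong]: "sets M = sets (borel \<Otimes>\<^sub>M borel)"
    unfolding M_def by (intro sets_pair_measure_cong) simp_all
  have sets_GH [measurable_cong, simp]: "sets G = sets borel" "sets H = sets borel"
    by (simp_all add: G_def H_def)
  interpret Q: prob_space "gaussian 0 \<tau>" by (rule prob_space_gaussian[OF assms])
  interpret N: prob_space "gaussian 0 1" by (rule prob_space_gaussian) simp
  interpret G: prob_space G unfolding G_def by (rule prob_space_gaussian) (simp add: pos)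
  interpret H: prob_space H unfolding H_def by (rule prob_space_gaussian) (simp add: pos)
  interpret QN: pair_prob_space "gaussian 0 \<tau>" "gaussian 0 1" ..
  interpret GH: pair_prob_space G H ..
  interpret M: prob_space M unfolding M_def by (rule QN.prob_space_axioms)
  have Z_meas [measurable]: "Z \<in> borel_measurable M" unfolding Z_def by measurable
  have W_meas [measurable]: "W \<in> borel_measurable M" unfolding W_def Z_def by measurable
  have sub: "subalgebra M F"
    unfolding subalgebra_def F_def by (simp add: sets_image_in_sets)
  interpret finite_measure_subalgebra M F
    by unfold_locales (rule sub)
  have law: "distr M (borel \<Otimes>\<^sub>M borel) (\<lambda>p. (Z p, W p)) = G \<Otimes>\<^sub>M H"
    using distr_observation_residual[OF assms]
    by (simp add: M_def Z_def W_def G_def H_def c_def case_prod_beta')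
  \<comment> \<open>Independence of \<open>Z\<close> and \<open>W\<close> in the form used below:
    expectations of products factor. With one factor constantly 1 it also yields the moments of
    \<open>Z\<close> and \<open>W\<close> separately.\<close>
  have transfer: "has_bochner_integral M (\<lambda>p. f (Z p) * g (W p)) (I * K)"
    if "has_bochner_integral G f I" "has_bochner_integral H g K"
      for f g :: "real \<Rightarrow> real" and I K
  proof -
    have f: "integrable G f" "integral\<^sup>L G f = I" and g: "integrable H g" "integral\<^sup>L H g = K"
      using that by (auto simp: has_bochner_integral_iff)
    have [measurable]: "f \<in> borel_measurable borel" "g \<in> borel_measurable borel"
      using borel_measurable_integrable[OF f(1)] borel_measurable_integrable[OF g(1)]
      by (simp_all cong: measurable_cong_sets)
    have GH_int: "integrable (G \<Otimes>\<^sub>M H) (\<lambda>p. f (fst p) * g (snd p))"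
    proof (rule GH.Fubini_integrable)
      have "(\<lambda>x. \<integral>y. norm (f (fst (x, y)) * g (snd (x, y))) \<partial>H) = (\<lambda>x. \<bar>f x\<bar> * (\<integral>y. \<bar>g y\<bar> \<partial>H))"
        by (simp add: abs_mult)
      then show "integrable G (\<lambda>x. \<integral>y. norm (f (fst (x, y)) * g (snd (x, y))) \<partial>H)"
        using f(1) by simp
    qed (use g(1) in simp_all)
    have "integral\<^sup>L (G \<Otimes>\<^sub>M H) (\<lambda>p. f (fst p) * g (snd p)) = I * K"
      using GH.integral_fst'[OF GH_int] f g by simp
    with GH_int show ?thesis
      \<comment> \<open>Reading the product measure as a pushforward of \<open>M\<close> carries the
        integral back to \<open>M\<close>.\<close>
      unfolding law[symmetric]
      by (simp add: has_bochner_integral_iff integrable_distr_eq integral_distr)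
  qed
  have one_G: "has_bochner_integral G (\<lambda>_. 1::real) 1"
    by (simp add: has_bochner_integral_iff G.prob_space)
  have one_H: "has_bochner_integral H (\<lambda>_. 1::real) 1"
    by (simp add: has_bochner_integral_iff H.prob_space)
  have mean_G: "has_bochner_integral G (\<lambda>x. x) 0"
    unfolding G_def by (rule gaussian_mean) (simp add: pos)
  have mean_H: "has_bochner_integral H (\<lambda>x. x) 0"
    unfolding H_def by (rule gaussian_mean) (simp add: pos)
  have "has_bochner_integral H (\<lambda>x. x\<^sup>2) ((sqrt c)\<^sup>2)"
    unfolding H_def by (rule gaussian_second_moment) (simp add: pos)
  from transfer[OF one_G this] have W_sq: "has_bochner_integral M (\<lambda>p. (W p)\<^sup>2) c"
    using pos by simp
  have Z_int: "integrable M Z"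
    using transfer[OF mean_G one_H] by (simp add: has_bochner_integral_iff)
  have W_int: "integrable M W"
    using transfer[OF one_G mean_H] by (simp add: has_bochner_integral_iff)
  have fst_eq: "fst = (\<lambda>p. W p + c * Z p)"
    by (simp add: W_def)
  have fst_int: "integrable M fst"
    unfolding fst_eq using Z_int W_int by simp
  have cond_exp: "AE p in M. real_cond_exp M F fst p = c * Z p"
  \<comment> \<open>Since \<open>fst\<close> is \<open>W\<close> plus \<open>c * Z\<close>, and the
    latter is \<open>F\<close>-measurable, it remains to see that \<open>W\<close> integrates to 0
    over every set of \<open>F\<close>. Such a set is a preimage of some \<open>B\<close> under
    \<open>Z\<close>, so \<open>transfer\<close> applies to the indicator of \<open>B\<close> and
    the centred residual.\<close>
  proof (rule real_cond_exp_charact)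
    fix A assume A: "A \<in> sets F"
    then obtain B where B [measurable]: "B \<in> sets borel" and A_eq: "A = Z -` B \<inter> space M"
      by (auto simp: F_def sets_vimage_algebra2)
    have A_M [measurable]: "A \<in> sets M"
      using A sub by (auto simp: subalgebra_def)
    have "has_bochner_integral G (indicator B) (measure G B)"
      using has_bochner_integral_real_indicator[of B G] by (simp add: less_top[symmetric])
    from transfer[OF this mean_H] have "(\<integral>p. indicator B (Z p) * W p \<partial>M) = 0"
      by (simp add: has_bochner_integral_iff)
    moreover have "(\<integral>p\<in>A. W p \<partial>M) = (\<integral>p. indicator B (Z p) * W p \<partial>M)"
      unfolding set_lebesgue_integral_def
      by (rule Bochner_Integration.integral_cong) (auto simp: A_eq indicator_def)
    moreover have "(\<integral>p\<in>A. fst p \<partial>M) = (\<integral>p\<in>A. W p \<partial>M) + (\<integral>p\<in>A. c * Z p \<partial>M)"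
    proof -
      have "(\<integral>p\<in>A. W p + c * Z p \<partial>M) = (\<integral>p\<in>A. W p \<partial>M) + (\<integral>p\<in>A. c * Z p \<partial>M)"
        using Z_int W_int
        by (intro set_integral_add[unfolded set_integrable_def] integrable_mult_indicator A_M
          integrable_mult_right)
      then show ?thesis by (simp add: W_def)
    qed
    ultimately show "(\<integral>p\<in>A. fst p \<partial>M) = (\<integral>p\<in>A. c * Z p \<partial>M)"
      by simp
  next
    show "(\<lambda>p. c * Z p) \<in> borel_measurable F"
      unfolding F_def by (intro borel_measurable_times borel_measurable_const measurable_vimage_algebra1) auto
  qed (use fst_int Z_int in auto)
  have [measurable]: "fst \<in> borel_measurable M" by (rule borel_measurable_integrable[OF fst_int])
  let ?V = "\<lambda>p. ennreal ((fst p - real_cond_exp M F fst p)\<^sup>2)"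
  have "mmse (gaussian 0 \<tau>) = (\<integral>\<^sup>+p. nn_cond_exp M F ?V p \<partial>M)"
    by (simp add: mmse_def cond_variance_given_def cond_variance_def F_def M_def Z_def Let_def)
  \<comment> \<open>The tower property, as the weight-1 case of \<open>nn_cond_exp_intg\<close>:
    only the mean of the conditional variance is wanted, so the conditional variance itself is never
    computed.\<close>
  also have "\<dots> = (\<integral>\<^sup>+p. ?V p \<partial>M)"
    using nn_cond_exp_intg[of "\<lambda>_. 1" ?V] by simp
  also have "\<dots> = (\<integral>\<^sup>+p. ennreal ((W p)\<^sup>2) \<partial>M)"
    using cond_exp by (intro nn_integral_cong_AE) (auto simp: W_def)
  also have "\<dots> = ennreal c"
    using W_sq by (subst nn_integral_eq_integral) (auto simp: has_bochner_integral_iff)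
  finally show ?thesis by (simp add: c_def)
qed

theorem proposition3p14:
  fixes \<sigma> k \<tau> :: real
  assumes "\<sigma> > 0" and "k > 0" and "\<tau> > 0"
  shows "J k \<sigma> \<tau> = ennreal (k\<^sup>2 * (\<sigma> - \<tau>)\<^sup>2 + \<tau>\<^sup>2 / (1 + \<tau>\<^sup>2))"
  using assms by (simp add: J_def W2_sq_gaussian mmse_gaussian ennreal_mult ennreal_plus)

end
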